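(* Let $$f_{m,n}=\mathbf{i}\,q_n+\mathbf{j}\,p_n e^{\frac{2\pi\mathbf{i}}{M}m}$$ be a discrete surface of revolution in $\mathbb{R}^3\cong\mathrm{Im}\,\mathbb{H}$, for some real-valued functions $p,q$ of $n$ and some $M\in\mathbb{N}$, $M>2$; it is discrete isothermic, with cross-ratios factorising function $\mu$ chosen as $$\frac1{\mu_{(m,n),(m+1,n)}}=\bigl|1-e^{\frac{2\pi\mathbf{i}}{M}}\bigr|^2,\qquad \frac1{\mu_{(m,n),(m,n+1)}}=-\frac{(p_n-p_{n+1})^2+(q_n-q_{n+1})^2}{p_np_{n+1}}.$$ Then, for $\rho,k\in\mathbb{N}$, any Darboux transform $\hat f$ of $f$ (considered over the $\rho$-fold cover in the $m$-direction) with spectral parameter $$\nu=\frac14\Bigl(1-\cot^2\frac{\pi}{M}\,\tan^2\frac{k\pi}{\rho M}\Bigr)$$ gives a new discrete isothermic cylinder with period $\rho M$, i.e. a discrete isothermic surface with $\hat f_{m+\rho M,n}=\hat f_{m,n}$ for all $(m,n)$.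
   Context: $\mathbb{H}$ denotes the quaternions with basis $1,\mathbf{i},\mathbf{j},\mathbf{k}$. The domain is a rectangular domain in $\mathbb{Z}^2$ with points $(m,n)$. Vertices of an elementary quadrilateral: $i=(m,n)$, $j=(m+1,n)$, $k=(m+1,n+1)$, $\ell=(m,n+1)$. The cross-ratio is $\mathrm{cr}(a,b,c,d)=(a-b)(b-c)^{-1}(c-d)(d-a)^{-1}$. A discrete surface $f$ is discrete isothermic with cross-ratios factorising function $\mu$ (a real function on unoriented edges with $\mu_{ij}=\mu_{k\ell}$, $\mu_{i\ell}=\mu_{jk}$) if $\mathrm{cr}(f_i,f_j,f_k,f_\ell)=\mu_{i\ell}/\mu_{ij}$ on every elementary quadrilateral. A Darboux transform of $f$ with spectral parameter $\nu\in\mathbb{R}$ is a discrete $\mathbb{H}$-valued surface $\hat f$ with $\mathrm{cr}(f_i,f_j,\hat f_j,\hat f_i)=\nu/\mu_{ij}$ on every edge $(ij)$ of either direction.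
   Formalization: Added: p_n≠0 and consecutive (p_n,q_n) distinct, so that μ is defined; tan(kπ/(ρM)) defined; k not a multiple of ρM (there ν=1/4 and Darboux transforms need not close up); ν≠0, i.e. k≢±ρ mod ρM (there f̂ is constant and its cross-ratios are undefined). *)

theory Defs
  imports "HOL-Analysis.Analysis"
begin

section \<open>Quaternions\<close>

datatype quat = Quat (qRe: real) (qI: real) (qJ: real) (qK: real)

lemma quat_eq_iff:
  "x = y \<longleftrightarrow> qRe x = qRe y \<and> qI x = qI y \<and> qJ x = qJ y \<and> qK x = qK y"
  by (cases x; cases y) auto

definition quat_normsq :: "quat \<Rightarrow> real" where
  "quat_normsq x = (qRe x)\<^sup>2 + (qI x)\<^sup>2 + (qJ x)\<^sup>2 + (qK x)\<^sup>2"

lemma quat_normsq_eq_0_iff: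
  "quat_normsq x = 0 \<longleftrightarrow> qRe x = 0 \<and> qI x = 0 \<and> qJ x = 0 \<and> qK x = 0"
  unfolding quat_normsq_def by (auto simp: add_nonneg_eq_0_iff)

instantiation quat :: "{real_algebra_1, division_ring}"
begin

definition zero_quat :: quat where "0 = Quat 0 0 0 0"

definition one_quat :: quat where "1 = Quat 1 0 0 0"

definition plus_quat :: "quat \<Rightarrow> quat \<Rightarrow> quat" where
  "x + y = Quat (qRe x + qRe y) (qI x + qI y) (qJ x + qJ y) (qK x + qK y)"

definition minus_quat :: "quat \<Rightarrow> quat \<Rightarrow> quat" where
  "x - y = Quat (qRe x - qRe y) (qI x - qI y) (qJ x - qJ y) (qK x - qK y)"

definition uminus_quat :: "quat \<Rightarrow> quat" where
  "- x = Quat (- qRe x) (- qI x) (- qJ x) (- qK x)"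

definition times_quat :: "quat \<Rightarrow> quat \<Rightarrow> quat" where
  "x * y = Quat
     (qRe x * qRe y - qI x * qI y - qJ x * qJ y - qK x * qK y)
     (qRe x * qI y + qI x * qRe y + qJ x * qK y - qK x * qJ y)
     (qRe x * qJ y - qI x * qK y + qJ x * qRe y + qK x * qI y)
     (qRe x * qK y + qI x * qJ y - qJ x * qI y + qK x * qRe y)"

definition scaleR_quat :: "real \<Rightarrow> quat \<Rightarrow> quat" where
  "c *\<^sub>R x = Quat (c * qRe x) (c * qI x) (c * qJ x) (c * qK x)"

definition inverse_quat :: "quat \<Rightarrow> quat" where
  "inverse x = Quat (qRe x / quat_normsq x) (- qI x / quat_normsq x)
                    (- qJ x / quat_normsq x) (- qK x / quat_normsq x)"

definition divide_quat :: "quat \<Rightarrow> quat \<Rightarrow> quat" where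
  "divide_quat x y = x * inverse y"

instance
proof
  fix x y z :: quat and a b :: real
  note defs = quat_eq_iff zero_quat_def one_quat_def plus_quat_def minus_quat_def
    uminus_quat_def times_quat_def scaleR_quat_def
  show "x + y + z = x + (y + z)" "x + y = y + x" "0 + x = x" "- x + x = 0" "x - y = x + - y"
    by (simp_all add: defs)
  show "x * y * z = x * (y * z)" "(x + y) * z = x * z + y * z" "x * (y + z) = x * y + x * z"
    by (simp_all add: defs algebra_simps)
  show "1 * x = x" "x * 1 = x" "(0::quat) \<noteq> 1"
    by (simp_all add: defs)
  show "a *\<^sub>R (x + y) = a *\<^sub>R x + a *\<^sub>R y" "(a + b) *\<^sub>R x = a *\<^sub>R x + b *\<^sub>R x"
    "a *\<^sub>R b *\<^sub>R x = (a * b) *\<^sub>R x" "1 *\<^sub>R x = x"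
    "a *\<^sub>R x * y = a *\<^sub>R (x * y)" "x * a *\<^sub>R y = a *\<^sub>R (x * y)"
    by (simp_all add: defs algebra_simps)
  show "x div y = x * inverse y"
    by (simp add: divide_quat_def)
  show "inverse (0::quat) = 0"
    by (simp add: defs inverse_quat_def)
  {
    assume "x \<noteq> 0"
    then have nz: "quat_normsq x \<noteq> 0"
      by (auto simp: quat_normsq_eq_0_iff quat_eq_iff zero_quat_def)
    have 1: "qRe x * qRe x / quat_normsq x + qI x * qI x / quat_normsq x
        + qJ x * qJ x / quat_normsq x + qK x * qK x / quat_normsq x = 1"
      using nz by (simp add: quat_normsq_def power2_eq_square flip: add_divide_distrib)
    show "inverse x * x = 1" "x * inverse x = 1"
      using 1 by (simp_all add: defs inverse_quat_def)
  }
qed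

end

definition quat_i :: quat where "quat_i = Quat 0 1 0 0"
definition quat_j :: quat where "quat_j = Quat 0 0 1 0"
definition quat_k :: quat where "quat_k = Quat 0 0 0 1"

lemma quat_units:
  "quat_i * quat_i = -1" "quat_j * quat_j = -1" "quat_k * quat_k = -1"
  "quat_i * quat_j = quat_k" "quat_j * quat_k = quat_i" "quat_k * quat_i = quat_j"
  "quat_j * quat_i = - quat_k" "quat_k * quat_j = - quat_i" "quat_i * quat_k = - quat_j"
  by (simp_all add: quat_i_def quat_j_def quat_k_def times_quat_def uminus_quat_def one_quat_def)

text \<open>The embedding of the complex numbers that sends \<^term>\<open>\<i>\<close> to \<^const>\<open>quat_i\<close>.\<close>

definition quat_of_complex :: "complex \<Rightarrow> quat" where
  "quat_of_complex z = of_real (Re z) + of_real (Im z) * quat_i"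


section \<open>Discrete isothermic surfaces and Darboux transforms\<close>

definition cr :: "quat \<Rightarrow> quat \<Rightarrow> quat \<Rightarrow> quat \<Rightarrow> quat" where
  "cr a b c d = (a - b) * inverse (b - c) * (c - d) * inverse (d - a)"

text \<open>An equation between a cross-ratio and a real number includes that the two inverses in the
  cross-ratio exist; the library convention \<open>inverse 0 = 0\<close> must not supply a value.\<close>

definition has_real_cr :: "quat \<Rightarrow> quat \<Rightarrow> quat \<Rightarrow> quat \<Rightarrow> real \<Rightarrow> bool" where
  "has_real_cr a b c d r \<longleftrightarrow> b \<noteq> c \<and> d \<noteq> a \<and> cr a b c d = of_real r"

definition int_interval :: "int set \<Rightarrow> bool" where
  "int_interval I \<longleftrightarrow> (\<forall>a\<in>I. \<forall>c\<in>I. {a..c} \<subseteq> I)"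

text \<open>Rectangles may be unbounded, so \<open>\<int>\<^sup>2\<close> and strips are included.\<close>

definition rectangular_domain :: "(int \<times> int) set \<Rightarrow> bool" where
  "rectangular_domain D \<longleftrightarrow> (\<exists>I J. int_interval I \<and> int_interval J \<and> D = I \<times> J)"

text \<open>The edges of the lattice, listed from the lower to the upper endpoint. Functions on
  unoriented edges take the two-element set of endpoints as argument.\<close>

definition lattice_edge :: "int \<times> int \<Rightarrow> int \<times> int \<Rightarrow> bool" where
  "lattice_edge x y \<longleftrightarrow> y = (fst x + 1, snd x) \<or> y = (fst x, snd x + 1)"

text \<open>\<open>\<mu>\<close> must not vanish on the edges, because it occurs in denominators (for
  \<open>\<mu>\<^sub>i\<^sub>\<ell>\<close>, also because the cross-ratio of a face is nonzero).\<close>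

definition isothermic_with ::
    "(int \<times> int) set \<Rightarrow> (int \<times> int \<Rightarrow> quat) \<Rightarrow> ((int \<times> int) set \<Rightarrow> real) \<Rightarrow> bool" where
  "isothermic_with D f \<mu> \<longleftrightarrow>
     (\<forall>x\<in>D. \<forall>y\<in>D. lattice_edge x y \<longrightarrow> \<mu> {x, y} \<noteq> 0) \<and>
     (\<forall>m n. let i = (m, n); j = (m + 1, n); k = (m + 1, n + 1); l = (m, n + 1) in
        {i, j, k, l} \<subseteq> D \<longrightarrow>
          \<mu> {i, j} = \<mu> {k, l} \<and> \<mu> {i, l} = \<mu> {j, k} \<and>
          has_real_cr (f i) (f j) (f k) (f l) (\<mu> {i, l} / \<mu> {i, j}))"

definition isothermic :: "(int \<times> int) set \<Rightarrow> (int \<times> int \<Rightarrow> quat) \<Rightarrow> bool" where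
  "isothermic D f \<longleftrightarrow> (\<exists>\<mu>. isothermic_with D f \<mu>)"

definition darboux_transform ::
    "(int \<times> int) set \<Rightarrow> (int \<times> int \<Rightarrow> quat) \<Rightarrow> ((int \<times> int) set \<Rightarrow> real) \<Rightarrow> real \<Rightarrow>
     (int \<times> int \<Rightarrow> quat) \<Rightarrow> bool" where
  "darboux_transform D f \<mu> \<nu> fh \<longleftrightarrow>
     (\<forall>i\<in>D. \<forall>j\<in>D. lattice_edge i j \<longrightarrow>
        has_real_cr (f i) (f j) (fh j) (fh i) (\<nu> / \<mu> {i, j}))"

definition revolution_surface ::
    "nat \<Rightarrow> (int \<Rightarrow> real) \<Rightarrow> (int \<Rightarrow> real) \<Rightarrow> int \<times> int \<Rightarrow> quat" where
  "revolution_surface M p q = (\<lambda>(m, n).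
     quat_i * of_real (q n) +
     quat_j * of_real (p n) * quat_of_complex (exp (2 * of_real pi * \<i> / of_nat M * of_int m)))"

end

(*
  On an edge e of f, the Darboux condition for T = fh - f reads T' - T + e = r T' e^-1 T, and it forces
  e^-1 T and e^-1 T' to commute. Cancelling these symmetric forms around a face shows that the
  cross-ratio of f is inherited by fh. Along a parallel circle, homogeneous coordinates for T obey a
  linear recurrence that becomes a real one with constant coefficients in a frame rotating with
  half the speed of the surface. With phi = pi/M and psi = k pi/(rho M), the choice of nu makes its
  characteristic roots (cos phi / cos psi) exp(+- i psi). Since psi is no multiple of pi, they are
  distinct, and their powers with exponent rho M coincide and are real, so the monodromy is a real
  scalar and acts trivially on T.
*)
theory Submission
  imports Defs
begin

section \<open>Quaternionic cross-ratios on edges, faces and cubes\<close>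

instance quat :: real_div_algebra ..

text \<open>With \<open>e\<close>, \<open>S\<close>, \<open>T\<close> for \<open>b - a\<close>,
  \<open>c - b\<close>, \<open>d - a\<close>, the cross-ratio equation makes \<open>c - d\<close>
  equal to \<open>r\<close> times \<open>S * inverse e * T\<close>. Compared with
  \<open>c - d = S - T + e\<close>, this forces \<open>inverse e * S\<close> and
  \<open>inverse e * T\<close> to commute, so \<open>S\<close> and \<open>T\<close> may be
  exchanged. Both orders are recorded because later cancellations need one or the other.\<close>

lemma has_real_cr_edges:
  assumes "has_real_cr a b c d r" "r \<noteq> 0"
  shows "b - a \<noteq> 0" "c - b \<noteq> 0" "d - a \<noteq> 0" "c - d \<noteq> 0"
    and "c - d = of_real r * ((c - b) * inverse (b - a) * (d - a))"
    and "c - d = of_real r * ((d - a) * inverse (b - a) * (c - b))"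
proof -
  have cr: "(a - b) * inverse (b - c) * (c - d) * inverse (d - a) = of_real r"
    and bc: "b - c \<noteq> 0" and da: "d - a \<noteq> 0"
    using assms by (auto simp: has_real_cr_def cr_def)
  have r: "(of_real r :: quat) \<noteq> 0" using assms by simp
  show ba: "b - a \<noteq> 0" using cr r by auto
  show "c - d \<noteq> 0" using cr r by auto
  show cb: "c - b \<noteq> 0" using bc by auto
  show "d - a \<noteq> 0" by fact
  define e S T where "e = b - a" and "S = c - b" and "T = d - a"
  have nz: "e \<noteq> 0" "S \<noteq> 0" "T \<noteq> 0" using ba cb da by (auto simp: e_def S_def T_def)
  have "inverse (b - c) = - inverse S"
    by (metis S_def inverse_minus_eq minus_diff_eq)
  then have cr': "e * inverse S * (c - d) * inverse T = of_real r"
    using cr by (simp add: e_def T_def algebra_simps)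
  have "(c - d) = S * inverse e * (e * inverse S * (c - d) * inverse T) * T"
    using nz by (simp add: mult.assoc flip: mult.assoc[of "inverse e" e] mult.assoc[of S "inverse S"])
  also have "\<dots> = of_real r * (S * inverse e * T)"
    unfolding cr' by (simp add: mult.assoc of_real_def)
  finally have 1: "c - d = of_real r * (S * inverse e * T)" .
  then show "c - d = of_real r * ((c - b) * inverse (b - a) * (d - a))"
    by (simp add: S_def T_def e_def)
  define A B where "A = inverse e * T" and "B = inverse e * S"
  have "c - d = S - T + e" by (simp add: S_def T_def e_def)
  then have "inverse e * (S - T + e) = inverse e * (of_real r * (S * inverse e * T))"
    using 1 by simp
  then have BA: "B - A + 1 = of_real r * (B * A)"
    using nz by (simp add: A_def B_def algebra_simps mult.assoc of_real_def)
  \<comment> \<open>\<open>BA\<close> rearranges to \<open>B * (1 - of_real r * A) = A - 1\<close>.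
    If the factor is invertible, \<open>B\<close> is a rational function of \<open>A\<close> with
    real coefficients; otherwise \<open>A\<close> is the real number \<open>1 / r\<close>.\<close>
  have "B * A = A * B"
  proof (cases "1 - of_real r * A = 0")
    case True
    then have "of_real (1 / r) = of_real (1 / r) * (of_real r * A)"
      by simp
    then have "A = of_real (1 / r)"
      using assms(2) by (simp add: of_real_def)
    then show ?thesis by (simp add: of_real_def)
  next
    case False
    have e1: "B * (1 - of_real r * A) = A - 1"
      using BA by (simp add: algebra_simps of_real_def)
    have "(A * B) * (1 - of_real r * A) = A * (A - 1)"
      using e1 by (simp add: mult.assoc)
    also have "\<dots> = (A - 1) * A" by (simp add: algebra_simps)
    also have "\<dots> = B * (1 - of_real r * A) * A" by (simp add: e1)
    also have "\<dots> = (B * A) * (1 - of_real r * A)" by (simp add: algebra_simps of_real_def)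
    finally show ?thesis using False by simp
  qed
  then have "e * (B * A) = e * (A * B)" by simp
  then have "S * inverse e * T = T * inverse e * S"
    using nz by (simp add: A_def B_def flip: mult.assoc)
  then show "c - d = of_real r * ((d - a) * inverse (b - a) * (c - b))"
    using 1 by (simp add: S_def T_def e_def)
qed

text \<open>Three-dimensional consistency of the cross-ratio system. Writing each edge of the fourth face
  in the one of its two forms that makes the inner factors cancel leaves the cross-ratio of the
  original face, conjugated.\<close>

lemma has_real_cr_cube:
  assumes f: "has_real_cr f1 f2 f3 f4 (r / s)"
    and g12: "has_real_cr f1 f2 g2 g1 r" and g14: "has_real_cr f1 f4 g4 g1 s"
    and g23: "has_real_cr f2 f3 g3 g2 s" and g43: "has_real_cr f4 f3 g3 g4 r"
    and r: "r \<noteq> 0" and s: "s \<noteq> 0"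
  shows "has_real_cr g1 g2 g3 g4 (r / s)"
proof -
  have rs: "r / s \<noteq> 0" using r s by simp
  define d1 d2 d3 d4 where d_def: "d1 = f2 - f1" "d2 = f3 - f2" "d3 = f3 - f4" "d4 = f4 - f1"
  define T1 T2 T3 T4 where T_def: "T1 = g1 - f1" "T2 = g2 - f2" "T3 = g3 - f3" "T4 = g4 - f4"
  note E = has_real_cr_edges
  have nz: "d1 \<noteq> 0" "d2 \<noteq> 0" "d3 \<noteq> 0" "d4 \<noteq> 0" "T1 \<noteq> 0" "T2 \<noteq> 0" "T3 \<noteq> 0" "T4 \<noteq> 0"
    using E(1-4)[OF f rs] E(1-4)[OF g12 r] E(1-4)[OF g43 r] by (simp_all add: d_def T_def)
  \<comment> \<open>The edge lemma also applies to the base face itself and expresses its fourth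
    edge through the other three.\<close>
  have d3: "d3 = of_real (r / s) * (d4 * inverse d1 * d2)"
    using E(6)[OF f rs] by (simp add: d_def)
  have h1: "g2 - g1 = of_real r * (T1 * inverse d1 * T2)"
    using E(6)[OF g12 r] by (simp add: d_def T_def)
  have h2: "g3 - g2 = of_real s * (T3 * inverse d2 * T2)"
    using E(5)[OF g23 s] by (simp add: d_def T_def)
  have h3: "g3 - g4 = of_real r * (T3 * inverse d3 * T4)"
    using E(5)[OF g43 r] by (simp add: d_def T_def)
  have h4: "g4 - g1 = of_real s * (T1 * inverse d4 * T4)"
    using E(6)[OF g14 s] by (simp add: d_def T_def)
  have c: "inverse x * (x * y) = y" "x * (inverse x * y) = y" if "x \<noteq> 0" for x y :: quat
    using that by (simp_all flip: mult.assoc)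
  have "cr g1 g2 g3 g4 = (g2 - g1) * inverse (g3 - g2) * (g3 - g4) * inverse (g4 - g1)"
  proof -
    have "inverse (g2 - g3) = - inverse (g3 - g2)"
      by (metis inverse_minus_eq minus_diff_eq)
    then show ?thesis by (simp add: cr_def algebra_simps)
  qed
  \<comment> \<open>\<open>T2\<close>, \<open>T3\<close>, \<open>T4\<close> cancel between
    neighbouring factors. What remains is a conjugate by \<open>T1\<close> of a product of the
    \<open>d\<close>s, which \<open>d3\<close> collapses to a real number.\<close>
  also have "\<dots> = of_real (r / s)"
    unfolding h1 h2 h3 h4 d3 using nz r s
    by (simp add: nonzero_inverse_mult_distrib inverse_scaleR_distrib mult.assoc c of_real_def)
       (simp add: field_simps)
  finally show ?thesis
    using E(4)[OF g23 s] E(4)[OF g14 s] by (simp add: has_real_cr_def)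
qed

text \<open>Corresponding faces of \<open>f\<close> and \<open>fh\<close> bound a cube whose side
  faces have cross-ratios \<open>\<nu> / \<mu>\<close>. In the quotient of two of these the nonzero
  \<open>\<nu>\<close> cancels, so \<open>fh\<close> inherits the same \<open>\<mu>\<close>.\<close>

lemma isothermic_darboux_transform:
  assumes f: "isothermic_with D f \<mu>" and fh: "darboux_transform D f \<mu> \<nu> fh" and "\<nu> \<noteq> 0"
  shows "isothermic_with D fh \<mu>"
  unfolding isothermic_with_def
proof (intro conjI allI)
  show mu: "\<forall>x\<in>D. \<forall>y\<in>D. lattice_edge x y \<longrightarrow> \<mu> {x, y} \<noteq> 0"
    using f by (simp add: isothermic_with_def)
  fix m n :: int
  let ?i = "(m, n)" and ?j = "(m + 1, n)" and ?k = "(m + 1, n + 1)" and ?l = "(m, n + 1)"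
  have "\<mu> {?i, ?j} = \<mu> {?k, ?l} \<and> \<mu> {?i, ?l} = \<mu> {?j, ?k} \<and>
      has_real_cr (fh ?i) (fh ?j) (fh ?k) (fh ?l) (\<mu> {?i, ?l} / \<mu> {?i, ?j})"
    if D: "{?i, ?j, ?k, ?l} \<subseteq> D"
  proof -
    have fm: "\<mu> {?i, ?j} = \<mu> {?k, ?l}" "\<mu> {?i, ?l} = \<mu> {?j, ?k}"
      and ff: "has_real_cr (f ?i) (f ?j) (f ?k) (f ?l) (\<mu> {?i, ?l} / \<mu> {?i, ?j})"
      using f D unfolding isothermic_with_def Let_def by blast+
    have edges: "lattice_edge ?i ?j" "lattice_edge ?i ?l" "lattice_edge ?j ?k" "lattice_edge ?l ?k"
      by (simp_all add: lattice_edge_def)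
    have nz: "\<mu> {?i, ?j} \<noteq> 0" "\<mu> {?i, ?l} \<noteq> 0"
      using mu edges D by auto
    have g: "has_real_cr (f ?i) (f ?j) (fh ?j) (fh ?i) (\<nu> / \<mu> {?i, ?j})"
      "has_real_cr (f ?i) (f ?l) (fh ?l) (fh ?i) (\<nu> / \<mu> {?i, ?l})"
      "has_real_cr (f ?j) (f ?k) (fh ?k) (fh ?j) (\<nu> / \<mu> {?j, ?k})"
      "has_real_cr (f ?l) (f ?k) (fh ?k) (fh ?l) (\<nu> / \<mu> {?l, ?k})"
      using fh edges D by (auto simp: darboux_transform_def)
    have kl: "\<nu> / \<mu> {?l, ?k} = \<nu> / \<mu> {?i, ?j}" "\<nu> / \<mu> {?j, ?k} = \<nu> / \<mu> {?i, ?l}"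
      unfolding fm by (simp_all only: insert_commute)
    have eq: "(\<nu> / \<mu> {?i, ?j}) / (\<nu> / \<mu> {?i, ?l}) = \<mu> {?i, ?l} / \<mu> {?i, ?j}"
      using nz \<open>\<nu> \<noteq> 0\<close> by simp
    have "\<nu> / \<mu> {?i, ?j} \<noteq> 0" "\<nu> / \<mu> {?i, ?l} \<noteq> 0"
      using nz \<open>\<nu> \<noteq> 0\<close> by simp_all
    from has_real_cr_cube[OF ff[folded eq] g(1,2) g(3)[unfolded kl] g(4)[unfolded kl] this]
    show ?thesis using fm unfolding eq by blast
  qed
  then show "let i = ?i; j = ?j; k = ?k; l = ?l in
        {i, j, k, l} \<subseteq> D \<longrightarrow>
          \<mu> {i, j} = \<mu> {k, l} \<and> \<mu> {i, l} = \<mu> {j, k} \<and>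
          has_real_cr (fh i) (fh j) (fh k) (fh l) (\<mu> {i, l} / \<mu> {i, j})"
    unfolding Let_def by blast
qed

section \<open>Complex numbers inside the quaternions and the faces of a surface of
  revolution\<close>

lemma quat_of_complex_eq: "quat_of_complex z = Quat (Re z) (Im z) 0 0"
  by (simp add: quat_of_complex_def of_real_def scaleR_quat_def one_quat_def plus_quat_def
      times_quat_def quat_i_def)

lemma of_real_quat_eq: "of_real r = Quat r 0 0 0"
  by (simp add: of_real_def scaleR_quat_def one_quat_def)

lemma quat_of_complex_mult: "quat_of_complex (z * w) = quat_of_complex z * quat_of_complex w"
  by (simp add: quat_of_complex_eq times_quat_def)

lemma quat_of_complex_diff: "quat_of_complex (z - w) = quat_of_complex z - quat_of_complex w"
  by (simp add: quat_of_complex_eq minus_quat_def)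

lemma quat_of_complex_add: "quat_of_complex (z + w) = quat_of_complex z + quat_of_complex w"
  by (simp add: quat_of_complex_eq plus_quat_def)

lemma quat_of_complex_of_real: "quat_of_complex (of_real r) = of_real r"
  by (simp add: quat_of_complex_eq of_real_quat_eq)

lemma quat_of_complex_eq_0_iff: "quat_of_complex z = 0 \<longleftrightarrow> z = 0"
  by (simp add: quat_of_complex_eq zero_quat_def complex_eq_iff)

lemma quat_j_quat_of_complex: "quat_j * quat_of_complex z = quat_of_complex (cnj z) * quat_j"
  by (simp add: quat_of_complex_eq quat_j_def times_quat_def)

lemma revolution_surface_cis:
  "revolution_surface M p q (m, n) =
     quat_i * of_real (q n) + quat_j * of_real (p n) * quat_of_complex (cis (2 * pi / M * m))"
proof -
  have "exp (2 * of_real pi * \<i> / of_nat M * of_int m) = cis (2 * pi / M * m)"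
    unfolding cis_conv_exp by (rule arg_cong[where f = exp]) simp
  then show ?thesis by (simp only: revolution_surface_def prod.case)
qed

lemma revolution_surface_Quat:
  "revolution_surface M p q (m, n) =
     Quat 0 (q n) (p n * cos (2 * pi / M * m)) (- p n * sin (2 * pi / M * m))"
  unfolding revolution_surface_cis
  by (simp add: quat_of_complex_eq of_real_quat_eq quat_i_def quat_j_def times_quat_def plus_quat_def)

lemma cmod_one_minus_cis_double: "(cmod (1 - cis (2 * x)))\<^sup>2 = 4 * (sin x)\<^sup>2"
proof -
  have "(1 - (1 - 2 * s\<^sup>2))\<^sup>2 + (2 * s * c)\<^sup>2 = 4 * s\<^sup>2 * (s\<^sup>2 + c\<^sup>2)" for s c :: real
    by (simp add: power2_eq_square algebra_simps)
  from this[of "sin x" "cos x"] show ?thesis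
    by (simp add: cmod_power2 sin_double cos_double_sin)
qed

text \<open>The key relation \<open>e2 * e3 = - (e3 * e4)\<close> holds because a face is an isosceles trapezoid.\<close>

lemma revolution_surface_face:
  fixes p q :: "int \<Rightarrow> real" and m n :: int and M :: nat
  defines "f \<equiv> revolution_surface M p q"
  defines "N \<equiv> (p n - p (n + 1))\<^sup>2 + (q n - q (n + 1))\<^sup>2"
  assumes p: "p n \<noteq> 0" "p (n + 1) \<noteq> 0" and pq: "(p n, q n) \<noteq> (p (n + 1), q (n + 1))"
    and w: "cis (2 * pi / M) \<noteq> 1"
  shows "has_real_cr (f (m, n)) (f (m + 1, n)) (f (m + 1, n + 1)) (f (m, n + 1))
    ((cmod (1 - cis (2 * pi / M)))\<^sup>2 / - (N / (p n * p (n + 1))))"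
proof -
  define \<theta> where "\<theta> = 2 * pi / M"
  define c s C S where cs: "c = cos (\<theta> * m)" "s = sin (\<theta> * m)"
    "C = cos (\<theta> * (m + 1))" "S = sin (\<theta> * (m + 1))"
  have 1: "c\<^sup>2 + s\<^sup>2 = 1" "C\<^sup>2 + S\<^sup>2 = 1" by (simp_all add: cs)
  define e1 e2 e3 e4 where e_def: "e1 = f (m + 1, n) - f (m, n)"
    "e2 = f (m + 1, n + 1) - f (m + 1, n)"
    "e3 = f (m + 1, n + 1) - f (m, n + 1)" "e4 = f (m, n + 1) - f (m, n)"
  have e1: "e1 = Quat 0 0 (p n * (C - c)) (- p n * (S - s))"
    and e3: "e3 = Quat 0 0 (p (n + 1) * (C - c)) (- p (n + 1) * (S - s))"
    and e2: "e2 = Quat 0 (q (n + 1) - q n) ((p (n + 1) - p n) * C) (- (p (n + 1) - p n) * S)"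
    and e4: "e4 = Quat 0 (q (n + 1) - q n) ((p (n + 1) - p n) * c) (- (p (n + 1) - p n) * s)"
    by (simp_all add: e_def f_def revolution_surface_Quat minus_quat_def cs \<theta>_def algebra_simps)
  have N: "N \<noteq> 0" using pq by (simp add: N_def sum_power2_eq_zero_iff)
  define W where "W = (cmod (1 - cis \<theta>))\<^sup>2"
  have W0: "W \<noteq> 0" using w by (simp add: W_def \<theta>_def)
  \<comment> \<open>\<open>W\<close> is the squared chord between neighbouring points of the unit
    circle; turning the chord by \<open>cis (\<theta> * m)\<close> preserves its length.\<close>
  have "W = (C - c)\<^sup>2 + (S - s)\<^sup>2"
  proof -
    have "cis (\<theta> * m) * (1 - cis \<theta>) = cis (\<theta> * m) - cis (\<theta> * (m + 1))"
      by (simp add: algebra_simps cis_mult)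
    then have "cmod (1 - cis \<theta>) = cmod (cis (\<theta> * m) - cis (\<theta> * (m + 1)))"
      by (metis norm_cis norm_mult mult_1)
    then show ?thesis by (simp add: W_def cmod_power2 cs power2_commute)
  qed
  then have W': "(C - c)\<^sup>2 + (S - s)\<^sup>2 = W" by simp
  have sq: "x * x = - of_real N" if x: "x = Quat 0 (q (n + 1) - q n) ((p (n + 1) - p n) * c) (- (p (n + 1) - p n) * s)"
    and 1: "c\<^sup>2 + s\<^sup>2 = 1" for x c s
  proof -
    have "(q (n + 1) - q n)\<^sup>2 + (p (n + 1) - p n)\<^sup>2 * (c\<^sup>2 + s\<^sup>2) = N"
      unfolding 1 N_def by (simp add: power2_commute)
    then show ?thesis unfolding x of_real_quat_eq
      by (simp add: times_quat_def uminus_quat_def power2_eq_square algebra_simps)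
  qed
  have e22: "e2 * e2 = - of_real N" and e44: "e4 * e4 = - of_real N"
    using sq[OF e2 1(2)] sq[OF e4 1(1)] by auto
  have e11: "e1 * e1 = - of_real ((p n)\<^sup>2 * W)"
    unfolding e1 of_real_quat_eq W'[symmetric]
    by (simp add: times_quat_def uminus_quat_def power2_eq_square algebra_simps)
  have e13: "of_real (p n) * e3 = of_real (p (n + 1)) * e1"
    unfolding e1 e3 of_real_quat_eq
    by (simp add: times_quat_def algebra_simps)
  \<comment> \<open>\<open>e2\<close> is the mirror image of \<open>e4\<close> in the plane
    orthogonal to \<open>e3\<close>, while conjugation by the imaginary quaternion \<open>e3\<close>
    is the half-turn about it, the negative of that reflection.\<close>
  have e23: "e2 * e3 = - (e3 * e4)"
  proof -
    have "C * C + S * S = c * c + s * s" using 1 by (simp add: power2_eq_square)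
    then have "p (n + 1) * P * (C * C + S * S) = p (n + 1) * P * (c * c + s * s)" for P
      by simp
    from this[of "p n"] this[of "p (n + 1)"] show ?thesis unfolding e2 e3 e4
      by (simp add: times_quat_def uminus_quat_def algebra_simps)
  qed
  have nz: "e2 \<noteq> 0" "e4 \<noteq> 0" using e22 e44 N by auto
  have inv: "inverse x = of_real (- 1 / N) * x" if "x * x = - of_real N" for x :: quat
    using that N by (intro inverse_unique) (simp add: of_real_def)
  have "cr (f (m, n)) (f (m + 1, n)) (f (m + 1, n + 1)) (f (m, n + 1)) = e1 * inverse e2 * e3 * inverse e4"
  proof -
    have "inverse (- e2) = - inverse e2" by simp
    then show ?thesis by (simp add: cr_def e_def algebra_simps)
  qed
  \<comment> \<open>Both inverses are real multiples of the edges. Moving \<open>e3\<close> to the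
    left then produces \<open>e4 * e4\<close>, which is real, and leaves the product of the parallel
    edges \<open>e1\<close> and \<open>e3\<close>, which is real too.\<close>
  also have "\<dots> = of_real (1 / N\<^sup>2) * (e1 * (e2 * e3) * e4)"
    by (simp add: inv e22 e44 of_real_def mult.assoc power2_eq_square)
  also have "\<dots> = of_real (1 / N\<^sup>2) * - (e1 * e3 * (e4 * e4))"
    unfolding e23 by (simp add: mult.assoc)
  also have "\<dots> = of_real (1 / N) * (e1 * e3)"
    unfolding e44 using N by (simp add: of_real_def power2_eq_square)
  also have "e1 * e3 = of_real (p (n + 1) / p n) * (e1 * e1)"
  proof -
    have "e3 = of_real (1 / p n) * (of_real (p n) * e3)"
      using p by (simp add: of_real_def)
    then have "e3 = of_real (1 / p n) * (of_real (p (n + 1)) * e1)"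
      unfolding e13 .
    then show ?thesis by (simp add: of_real_def)
  qed
  also have "of_real (1 / N) * (of_real (p (n + 1) / p n) * (e1 * e1)) =
      of_real (W / - (N / (p n * p (n + 1))))"
    unfolding e11 using p N by (simp add: of_real_def power2_eq_square)
  finally show ?thesis
    using nz unfolding has_real_cr_def W_def \<theta>_def e_def by auto
qed

section \<open>Linear recurrences and the monodromy along a parallel circle\<close>

text \<open>The characteristic roots are \<open>R\<close> times \<open>cis \<psi>\<close> and
  \<open>cis (- \<psi>)\<close>. The usual closed form is multiplied by
  \<open>R * sin \<psi>\<close> to avoid a division. The index shift \<open>real t - 1\<close> is
  taken in the reals, so \<open>t = 0\<close> gives \<open>sin (- \<psi>)\<close>.\<close>

lemma linear_recurrence_trig:
  fixes X :: "nat \<Rightarrow> 'a::real_vector"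
  assumes "\<And>t. X (t + 2) = (2 * R * cos \<psi>) *\<^sub>R X (t + 1) - R\<^sup>2 *\<^sub>R X t"
  shows "(R * sin \<psi>) *\<^sub>R X t =
    (R ^ t * sin (t * \<psi>)) *\<^sub>R X 1 - (R ^ (t + 1) * sin ((real t - 1) * \<psi>)) *\<^sub>R X 0"
proof (induction t rule: induct_nat_012)
  case 0
  show ?case by simp
next
  case 1
  show ?case by simp
next
  case (ge2 t)
  have s: "sin ((real t + 2) * \<psi>) = 2 * cos \<psi> * sin ((real t + 1) * \<psi>) - sin (t * \<psi>)"
    "sin ((real t + 1) * \<psi>) = 2 * cos \<psi> * sin (t * \<psi>) - sin ((real t - 1) * \<psi>)"
  proof -
    have "sin (x + \<psi>) = 2 * cos \<psi> * sin x - sin (x - \<psi>)" for x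
      by (simp add: sin_add sin_diff)
    from this[of "(real t + 1) * \<psi>"] this[of "t * \<psi>"]
    show "sin ((real t + 2) * \<psi>) = 2 * cos \<psi> * sin ((real t + 1) * \<psi>) - sin (t * \<psi>)"
      "sin ((real t + 1) * \<psi>) = 2 * cos \<psi> * sin (t * \<psi>) - sin ((real t - 1) * \<psi>)"
      by (simp_all add: algebra_simps)
  qed
  have "(R * sin \<psi>) *\<^sub>R X (t + 2) =
      (2 * R * cos \<psi>) *\<^sub>R ((R * sin \<psi>) *\<^sub>R X (Suc t)) - R\<^sup>2 *\<^sub>R ((R * sin \<psi>) *\<^sub>R X t)"
    unfolding assms by (simp add: scaleR_right_diff_distrib mult_ac)
  also have "\<dots> = (R ^ (t + 2) * (2 * cos \<psi> * sin ((real t + 1) * \<psi>) - sin (t * \<psi>))) *\<^sub>R X 1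
      - (R ^ (t + 3) * (2 * cos \<psi> * sin (t * \<psi>) - sin ((real t - 1) * \<psi>))) *\<^sub>R X 0"
    unfolding ge2 by (simp add: algebra_simps power2_eq_square power_add power3_eq_cube)
  finally have "(R * sin \<psi>) *\<^sub>R X (t + 2) = (R ^ (t + 2) * sin ((real t + 2) * \<psi>)) *\<^sub>R X 1
      - (R ^ (t + 3) * sin ((real t + 1) * \<psi>)) *\<^sub>R X 0"
    by (simp only: s)
  moreover have "real (Suc (Suc t)) = real t + 2" "real t + 2 - 1 = real t + 1"
    "Suc (Suc t) = t + 2" "t + 2 + 1 = t + 3"
    by simp_all
  ultimately show ?case by (simp only:)
qed

text \<open>The coefficient \<open>cis (- 2 * \<phi>)\<close> need not commute with
  \<open>u\<close>. Turning \<open>u t\<close> by half that angle per step, in the opposite sense,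
  makes the coefficients real, since \<open>cis \<phi> + cis (- \<phi>)\<close> is real and
  \<open>R * cos \<psi> = cos \<phi>\<close>.\<close>

lemma rotated_recurrence_multiplier:
  fixes u :: "nat \<Rightarrow> quat" and \<phi> \<psi> :: real and N k \<rho> :: nat
  defines "R \<equiv> cos \<phi> / cos \<psi>"
  assumes u: "\<And>t. u (t + 2) =
      u (t + 1) + quat_of_complex (cis (- 2 * \<phi>)) * (u (t + 1) - of_real (R\<^sup>2) * u t)"
    and nz: "cos \<phi> \<noteq> 0" "cos \<psi> \<noteq> 0" "sin \<psi> \<noteq> 0"
    and N: "N * \<phi> = \<rho> * pi" "N * \<psi> = k * pi"
  shows "u N = of_real ((-1) ^ \<rho> * (-1) ^ k * R ^ N) * u 0"
proof -
  let ?Q = quat_of_complex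
  have R: "R \<noteq> 0" using nz by (simp add: R_def)
  define X where "X t = ?Q (cis (t * \<phi>)) * u t" for t
  have X: "X (t + 2) = (2 * R * cos \<psi>) *\<^sub>R X (t + 1) - R\<^sup>2 *\<^sub>R X t" for t
  proof -
    have c1: "cis (real (t + 2) * \<phi>) + cis (real (t + 2) * \<phi>) * cis (- 2 * \<phi>) =
        of_real (2 * cos \<phi>) * cis (real (t + 1) * \<phi>)"
    proof -
      have "cis (real (t + 2) * \<phi>) = cis (real (t + 1) * \<phi>) * cis \<phi>"
        and "cis (real (t + 2) * \<phi>) * cis (- 2 * \<phi>) = cis (real (t + 1) * \<phi>) * cis (- \<phi>)"
        by (simp_all add: cis_mult algebra_simps)
      then have "cis (real (t + 2) * \<phi>) + cis (real (t + 2) * \<phi>) * cis (- 2 * \<phi>) =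
          cis (real (t + 1) * \<phi>) * (cis \<phi> + cis (- \<phi>))"
        by (simp only: distrib_left)
      also have "cis \<phi> + cis (- \<phi>) = of_real (2 * cos \<phi>)"
        by (simp add: complex_eq_iff)
      finally show ?thesis by (simp only: mult.commute)
    qed
    have c2: "cis (real (t + 2) * \<phi>) * cis (- 2 * \<phi>) = cis (t * \<phi>)"
      by (simp add: cis_mult algebra_simps)
    have "X (t + 2) = (?Q (cis (real (t + 2) * \<phi>)) +
          ?Q (cis (real (t + 2) * \<phi>)) * ?Q (cis (- 2 * \<phi>))) * u (t + 1)
        - ?Q (cis (real (t + 2) * \<phi>)) * ?Q (cis (- 2 * \<phi>)) * (of_real (R\<^sup>2) * u t)"
      unfolding X_def u by (simp add: algebra_simps)
    also have "\<dots> = of_real (2 * cos \<phi>) * X (t + 1) - ?Q (cis (t * \<phi>)) * (of_real (R\<^sup>2) * u t)"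
      unfolding quat_of_complex_mult[symmetric] quat_of_complex_add[symmetric]
      unfolding c1 unfolding c2
      by (simp only: X_def quat_of_complex_mult quat_of_complex_of_real mult.assoc)
    also have "\<dots> = (2 * cos \<phi>) *\<^sub>R X (t + 1) - R\<^sup>2 *\<^sub>R X t"
      by (simp add: of_real_def X_def)
    finally show ?thesis using nz by (simp add: R_def)
  qed
  \<comment> \<open>At \<open>t = N\<close> the term with \<open>X 1\<close> drops out, so
    \<open>X N\<close> is a real multiple of \<open>X 0\<close> alone.\<close>
  have sN: "sin (N * \<psi>) = 0" "sin ((real N - 1) * \<psi>) = - ((-1) ^ k * sin \<psi>)"
    unfolding left_diff_distrib N by (simp_all add: sin_diff)
  have "(R * sin \<psi>) *\<^sub>R X N = (R * sin \<psi>) *\<^sub>R (((-1) ^ k * R ^ N) *\<^sub>R X 0)"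
    unfolding linear_recurrence_trig[of X, OF X] sN by (simp add: mult_ac)
  then have "X N = ((-1) ^ k * R ^ N) *\<^sub>R X 0"
    unfolding scaleR_cancel_left using R nz by simp
  \<comment> \<open>After \<open>N\<close> steps the rotating frame has made \<open>\<rho>\<close>
    half-turns, which contributes only a sign.\<close>
  moreover have "X N = ((-1) ^ \<rho>) *\<^sub>R u N"
  proof -
    have "cis (N * \<phi>) = of_real ((-1) ^ \<rho>)"
      unfolding N by (simp add: complex_eq_iff)
    then show ?thesis
      unfolding X_def by (simp only: quat_of_complex_of_real) (simp add: of_real_def)
  qed
  moreover have "X 0 = u 0"
    by (simp add: X_def quat_of_complex_eq flip: one_quat_def)
  ultimately have "(-1) ^ \<rho> *\<^sub>R ((-1) ^ \<rho> *\<^sub>R u N) = (-1) ^ \<rho> *\<^sub>R (((-1) ^ k * R ^ N) *\<^sub>R u 0)"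
    by simp
  moreover have "(-1) ^ \<rho> * (-1) ^ \<rho> = (1 :: real)"
    by (simp flip: power_add mult_2)
  ultimately show ?thesis by (simp add: of_real_def mult.assoc)
qed

text \<open>In homogeneous coordinates \<open>fh - f = x y\<^sup>-\<^sup>1\<close> the Riccati-type equation of the Darboux transform
  becomes linear, and both coordinates satisfy the same second-order recurrence. Hence over the
  whole period both are multiplied by the same nonzero real number.\<close>

lemma darboux_row_closed:
  fixes f fh :: "nat \<Rightarrow> quat" and \<phi> \<psi> r :: real and N k \<rho> :: nat
  assumes cr: "\<And>t. t < N \<Longrightarrow> has_real_cr (f t) (f (t + 1)) (fh (t + 1)) (fh t) r"
    and r: "r \<noteq> 0" "1 - r = (cos \<phi> / cos \<psi>)\<^sup>2"
    and e0: "\<And>t. f (t + 1) - f t \<noteq> 0"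
    and eL: "\<And>t. f (t + 2) - f (t + 1) = quat_of_complex (cis (- 2 * \<phi>)) * (f (t + 1) - f t)"
    and eR: "\<And>t. f (t + 2) - f (t + 1) = (f (t + 1) - f t) * quat_of_complex (cis (2 * \<phi>))"
    and nz: "cos \<phi> \<noteq> 0" "cos \<psi> \<noteq> 0" "sin \<psi> \<noteq> 0"
    and N: "N * \<phi> = \<rho> * pi" "N * \<psi> = k * pi"
    and closed: "f N = f 0"
  shows "fh N = fh 0"
proof -
  let ?Q = quat_of_complex
  define e T where "e t = f (t + 1) - f t" and "T t = fh t - f t" for t
  \<comment> \<open>Solving the edge equation for the next \<open>T\<close> gives \<open>T (t + 1) *
    (1 - of_real r * (inverse (e t) * T t)) = T t - e t\<close>; with
    \<open>T = x * inverse y\<close> numerator and denominator become this linear step.\<close>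
  define z where "z = rec_nat (T 0, 1)
    (\<lambda>t (x, y). (x - e t * y, y - of_real r * (inverse (e t) * x)))"
  define x y where "x t = fst (z t)" and "y t = snd (z t)" for t
  have x0: "x 0 = T 0" "y 0 = 1" by (simp_all add: x_def y_def z_def)
  have xS: "x (t + 1) = x t - e t * y t"
    and yS: "y (t + 1) = y t - of_real r * (inverse (e t) * x t)" for t
    by (simp_all add: x_def y_def z_def split_def)
  have e: "e t \<noteq> 0" for t using e0 by (simp add: e_def)
  have r1: "r \<noteq> 1" using r(2) nz by auto
  \<comment> \<open>The linear recurrence runs over all \<open>t\<close>, but it represents
    \<open>T\<close> only up to \<open>N\<close>, where the cross-ratio equations are given.\<close>
  have xy: "y t \<noteq> 0 \<and> x t = T t * y t" if "t \<le> N" for t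
    using that
  proof (induction t)
    case 0
    show ?case by (simp add: x0)
  next
    case (Suc t)
    then have IH: "y t \<noteq> 0" "x t = T t * y t" by auto
    have "T (t + 1) - T t + e t = of_real r * (T (t + 1) * inverse (e t) * T t)"
      using has_real_cr_edges(5)[OF cr[of t] r(1)] Suc.prems by (simp add: e_def T_def)
    then have step: "T (t + 1) * (1 - of_real r * (inverse (e t) * T t)) = T t - e t"
      by (simp add: algebra_simps of_real_def)
    \<comment> \<open>A vanishing denominator would force \<open>T t = e t\<close> and then
      \<open>r = 1\<close>, which \<open>cos \<phi> \<noteq> 0\<close> excludes.\<close>
    have fac: "1 - of_real r * (inverse (e t) * T t) \<noteq> 0"
    proof
      assume *: "1 - of_real r * (inverse (e t) * T t) = 0"
      then have "T t = e t" using step by simp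
      then have "of_real r = (1::quat)" using * e by simp
      then show False using r1 by simp
    qed
    have y: "y (t + 1) = (1 - of_real r * (inverse (e t) * T t)) * y t"
      unfolding yS IH(2) by (simp add: algebra_simps)
    have "x (t + 1) = (T t - e t) * y t"
      unfolding xS IH(2) by (simp add: algebra_simps)
    also have "\<dots> = T (t + 1) * y (t + 1)"
      unfolding y step[symmetric] by (simp add: mult.assoc)
    finally show ?case using y fac IH(1) by simp
  qed
  let ?w = "?Q (cis (- 2 * \<phi>))"
  have "?Q (cis (2 * \<phi>)) * ?w = ?Q 1"
    by (simp add: cis_mult flip: quat_of_complex_mult)
  then have invw: "inverse (?Q (cis (2 * \<phi>))) = ?w"
    using quat_of_complex_of_real[of 1] by (intro inverse_unique) simp
  have R: "of_real ((cos \<phi> / cos \<psi>)\<^sup>2) = (1 - of_real r :: quat)"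
    by (simp flip: r(2))
  \<comment> \<open>Eliminating \<open>y\<close> uses the rotation of the edges as a left
    factor.\<close>
  have "x (t + 2) = x (t + 1) + ?w * (x (t + 1) - of_real ((cos \<phi> / cos \<psi>)\<^sup>2) * x t)" for t
  proof -
    have "e (t + 1) * y (t + 1) = ?w * (e t * y (t + 1))"
      using eL by (simp add: e_def mult.assoc)
    also have "e t * y (t + 1) = x t - x (t + 1) - of_real r * x t"
      unfolding yS xS using e
      by (simp add: algebra_simps of_real_def flip: mult.assoc[of "e t" "inverse (e t)"])
    finally have E: "e (t + 1) * y (t + 1) = ?w * (x t - x (t + 1) - of_real r * x t)" .
    have "x (t + 2) = x (t + 1) - e (t + 1) * y (t + 1)"
      using xS[of "t + 1"] by simp
    then show ?thesis unfolding E R by (simp add: algebra_simps)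
  qed
  from rotated_recurrence_multiplier[of x, OF this nz N]
  have xN: "x N = of_real ((-1) ^ \<rho> * (-1) ^ k * (cos \<phi> / cos \<psi>) ^ N) * x 0" .
  \<comment> \<open>Eliminating \<open>x\<close> uses the rotation as a right factor: inversion
    reverses the order and makes it the same left factor \<open>?w\<close>.\<close>
  have "y (t + 2) = y (t + 1) + ?w * (y (t + 1) - of_real ((cos \<phi> / cos \<psi>)\<^sup>2) * y t)" for t
  proof -
    have "e (t + 1) = e t * ?Q (cis (2 * \<phi>))"
      using eR by (simp add: e_def)
    then have "inverse (e (t + 1)) = ?w * inverse (e t)"
      using e[of t] invw by (simp add: quat_of_complex_eq_0_iff nonzero_inverse_mult_distrib)
    then have "of_real r * (inverse (e (t + 1)) * x (t + 1)) =
        ?w * (of_real r * (inverse (e t) * x (t + 1)))"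
      by (simp add: of_real_def mult.assoc)
    also have "inverse (e t) * x (t + 1) = inverse (e t) * x t - y t"
      unfolding xS using e[of t]
      by (simp add: right_diff_distrib flip: mult.assoc)
    also have "of_real r * (inverse (e t) * x t - y t) = y t - y (t + 1) - of_real r * y t"
      unfolding yS by (simp add: algebra_simps)
    finally have E: "of_real r * (inverse (e (t + 1)) * x (t + 1)) =
        ?w * (y t - y (t + 1) - of_real r * y t)" .
    have "y (t + 2) = y (t + 1) - of_real r * (inverse (e (t + 1)) * x (t + 1))"
      using yS[of "t + 1"] by simp
    then show ?thesis unfolding E R by (simp add: algebra_simps)
  qed
  from rotated_recurrence_multiplier[of y, OF this nz N]
  have yN: "y N = of_real ((-1) ^ \<rho> * (-1) ^ k * (cos \<phi> / cos \<psi>) ^ N) * y 0" .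
  define \<kappa> where "\<kappa> = (-1) ^ \<rho> * (-1) ^ k * (cos \<phi> / cos \<psi>) ^ N"
  have "\<kappa> \<noteq> 0" using nz by (simp add: \<kappa>_def)
  moreover have "x N = T N * y N" using xy by simp
  \<comment> \<open>The common multiplier is real, hence central, and cancels from
    \<open>x N = T N * y N\<close>.\<close>
  ultimately have "T N = T 0"
    unfolding xN yN x0 \<kappa>_def[symmetric] by (simp add: of_real_def)
  then show ?thesis using closed by (simp add: T_def)
qed

section \<open>Edges and factorising function of the surface of revolution\<close>

text \<open>Horizontal edges have the form \<open>quat_j\<close> times a complex number, and moving
  a complex factor past \<open>quat_j\<close> conjugates it. One rotation is therefore both a right
  factor and the conjugate left factor; the two homogeneous coordinates need one form each.\<close>

lemma revolution_surface_horizontal_edges: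
  fixes p q :: "int \<Rightarrow> real" and m n :: int and M :: nat
  defines "f \<equiv> revolution_surface M p q"
  assumes p: "p n \<noteq> 0" and w: "cis (2 * pi / M) \<noteq> 1"
  shows "f (m + 1, n) - f (m, n) \<noteq> 0"
    and "f (m + 2, n) - f (m + 1, n) =
      quat_of_complex (cis (- (2 * pi / M))) * (f (m + 1, n) - f (m, n))"
    and "f (m + 2, n) - f (m + 1, n) =
      (f (m + 1, n) - f (m, n)) * quat_of_complex (cis (2 * pi / M))"
proof -
  let ?Q = quat_of_complex
  define w z where "w = cis (2 * pi / M)" and "z m = cis (2 * pi / M * real_of_int m)" for m
  have z1: "z (l + 1) = z l * w" for l
    by (simp add: z_def w_def cis_mult distrib_left add_divide_distrib)
  then have z: "z (m + 1) = z m * w" "z (m + 2) = z m * w * w"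
    using z1[of "m + 1"] by (simp_all add: add.assoc)
  have E: "f (l, n) - f (m, n) = of_real (p n) * (quat_j * ?Q (z l - z m))" for l m
    by (simp add: f_def revolution_surface_cis quat_of_complex_diff z_def algebra_simps of_real_def)
  have E': "f (m + 2, n) - f (m + 1, n) = of_real (p n) * (quat_j * ?Q (z (m + 2) - z (m + 1)))"
    by (rule E)
  have "quat_j \<noteq> 0" by (simp add: quat_j_def zero_quat_def)
  moreover have "z (m + 1) - z m = z m * (w - 1)" unfolding z by (simp add: right_diff_distrib)
  then have "z (m + 1) - z m \<noteq> 0" using w by (simp add: z_def w_def)
  ultimately show "f (m + 1, n) - f (m, n) \<noteq> 0"
    unfolding E using p by (simp add: quat_of_complex_eq_0_iff)
  have zz: "z (m + 2) - z (m + 1) = (z (m + 1) - z m) * w"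
    unfolding z by (simp add: left_diff_distrib)
  show R: "f (m + 2, n) - f (m + 1, n) = (f (m + 1, n) - f (m, n)) * ?Q (cis (2 * pi / M))"
    unfolding E' E zz w_def[symmetric] by (simp add: quat_of_complex_mult mult.assoc)
  have "quat_j * ?Q (u * w) = ?Q (cis (- (2 * pi / M))) * (quat_j * ?Q u)" for u
  proof -
    have "quat_j * ?Q (u * w) = ?Q (cnj w * cnj u) * quat_j"
      by (simp add: quat_j_quat_of_complex mult.commute)
    also have "\<dots> = ?Q (cnj w) * (quat_j * ?Q u)"
      by (simp add: quat_of_complex_mult quat_j_quat_of_complex mult.assoc)
    finally show ?thesis by (simp add: w_def cis_cnj)
  qed
  then show "f (m + 2, n) - f (m + 1, n) = ?Q (cis (- (2 * pi / M))) * (f (m + 1, n) - f (m, n))"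
    unfolding E' E zz by (simp add: of_real_def)
qed

lemma revolution_surface_isothermic_with:
  fixes p q :: "int \<Rightarrow> real" and M :: nat
  defines "f \<equiv> revolution_surface M p q"
  assumes w: "cis (2 * pi / M) \<noteq> 1"
    and p: "\<And>m n. (m, n) \<in> D \<Longrightarrow> p n \<noteq> 0"
    and pq: "\<And>m n. (m, n) \<in> D \<Longrightarrow> (m, n + 1) \<in> D \<Longrightarrow> (p n, q n) \<noteq> (p (n + 1), q (n + 1))"
    and H: "\<And>m n. (m, n) \<in> D \<Longrightarrow> (m + 1, n) \<in> D \<Longrightarrow>
         1 / \<mu> {(m, n), (m + 1, n)} = (cmod (1 - cis (2 * pi / M)))\<^sup>2"
    and V: "\<And>m n. (m, n) \<in> D \<Longrightarrow> (m, n + 1) \<in> D \<Longrightarrow>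
         1 / \<mu> {(m, n), (m, n + 1)} =
           - (((p n - p (n + 1))\<^sup>2 + (q n - q (n + 1))\<^sup>2) / (p n * p (n + 1)))"
  shows "isothermic_with D f \<mu>"
  unfolding isothermic_with_def
proof (intro conjI allI ballI impI)
  fix x y :: "int \<times> int"
  assume xy: "x \<in> D" "y \<in> D" "lattice_edge x y"
  obtain m n where x: "x = (m, n)" by fastforce
  have "1 / \<mu> {x, y} \<noteq> 0"
  proof (cases "y = (m + 1, n)")
    case True
    then show ?thesis using H[of m n] xy w by (auto simp: x)
  next
    case False
    then have y: "y = (m, n + 1)" using xy by (simp add: x lattice_edge_def)
    have "(p n - p (n + 1))\<^sup>2 + (q n - q (n + 1))\<^sup>2 \<noteq> 0"
      using pq[of m n] xy by (simp add: x y sum_power2_eq_zero_iff)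
    then show ?thesis
      using V[of m n] p[of m n] p[of m "n + 1"] xy by (simp add: x y)
  qed
  \<comment> \<open>Since \<open>1 / 0 = 0\<close>, a nonzero reciprocal rules out a zero of
    \<open>\<mu>\<close>.\<close>
  then show "\<mu> {x, y} \<noteq> 0" by auto
next
  fix m n :: int
  let ?i = "(m, n)" and ?j = "(m + 1, n)" and ?k = "(m + 1, n + 1)" and ?l = "(m, n + 1)"
  have "\<mu> {?i, ?j} = \<mu> {?k, ?l} \<and> \<mu> {?i, ?l} = \<mu> {?j, ?k} \<and>
      has_real_cr (f ?i) (f ?j) (f ?k) (f ?l) (\<mu> {?i, ?l} / \<mu> {?i, ?j})"
    if D: "{?i, ?j, ?k, ?l} \<subseteq> D"
  proof -
    have ij: "1 / \<mu> {?i, ?j} = (cmod (1 - cis (2 * pi / M)))\<^sup>2"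
      and lk: "1 / \<mu> {?l, ?k} = (cmod (1 - cis (2 * pi / M)))\<^sup>2"
      using H[of m n] H[of m "n + 1"] D by auto
    have il: "1 / \<mu> {?i, ?l} = - (((p n - p (n + 1))\<^sup>2 + (q n - q (n + 1))\<^sup>2) / (p n * p (n + 1)))"
      and jk: "1 / \<mu> {?j, ?k} = - (((p n - p (n + 1))\<^sup>2 + (q n - q (n + 1))\<^sup>2) / (p n * p (n + 1)))"
      using V[of m n] V[of "m + 1" n] D by auto
    have inj: "a = b" if "1 / a = 1 / b" for a b :: real
      using that by (simp add: field_simps)
    have "{?l, ?k} = {?k, ?l}" by auto
    then have "\<mu> {?i, ?j} = \<mu> {?k, ?l}" "\<mu> {?i, ?l} = \<mu> {?j, ?k}"
      using inj ij lk il jk by metis+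
    moreover have "\<mu> {?i, ?l} / \<mu> {?i, ?j} = (1 / \<mu> {?i, ?j}) / (1 / \<mu> {?i, ?l})"
      by simp
    then have "has_real_cr (f ?i) (f ?j) (f ?k) (f ?l) (\<mu> {?i, ?l} / \<mu> {?i, ?j})"
      unfolding ij il f_def
      using revolution_surface_face[of p n q M m] p[of m n] p[of m "n + 1"] pq[of m n] w D by simp
    ultimately show ?thesis by blast
  qed
  then show "let i = ?i; j = ?j; k = ?k; l = ?l in
        {i, j, k, l} \<subseteq> D \<longrightarrow>
          \<mu> {i, j} = \<mu> {k, l} \<and> \<mu> {i, l} = \<mu> {j, k} \<and>
          has_real_cr (f i) (f j) (f k) (f l) (\<mu> {i, l} / \<mu> {i, j})"
    unfolding Let_def by blast
qed

section \<open>Closing of the Darboux transforms\<close>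

theorem mainTheorem5:
  fixes M \<rho> k :: nat
    and D :: "(int \<times> int) set"
    and p q :: "int \<Rightarrow> real"
    and \<mu> :: "(int \<times> int) set \<Rightarrow> real"
    and \<nu> :: real
    and f :: "int \<times> int \<Rightarrow> quat"
  assumes "M > 2"
    and "rectangular_domain D"
    and f_def: "f = revolution_surface M p q"
    and p_nonzero: "\<And>m n. (m, n) \<in> D \<Longrightarrow> p n \<noteq> 0"
    and profile_regular:
      "\<And>m n. (m, n) \<in> D \<Longrightarrow> (m, n + 1) \<in> D \<Longrightarrow> (p n, q n) \<noteq> (p (n + 1), q (n + 1))"
    and mu_horizontal:
      "\<And>m n. (m, n) \<in> D \<Longrightarrow> (m + 1, n) \<in> D \<Longrightarrow>
         1 / \<mu> {(m, n), (m + 1, n)} = (cmod (1 - exp (2 * of_real pi * \<i> / of_nat M)))\<^sup>2"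
    and mu_vertical:
      "\<And>m n. (m, n) \<in> D \<Longrightarrow> (m, n + 1) \<in> D \<Longrightarrow>
         1 / \<mu> {(m, n), (m, n + 1)} =
           - (((p n - p (n + 1))\<^sup>2 + (q n - q (n + 1))\<^sup>2) / (p n * p (n + 1)))"
    and "\<rho> > 0"
    and nu_def: "\<nu> = 1 / 4 * (1 - (cot (pi / M))\<^sup>2 * (tan (k * pi / (\<rho> * M)))\<^sup>2)"
    \<comment> \<open>the tangent is defined\<close>
    and tan_defined: "cos (k * pi / (\<rho> * M)) \<noteq> 0"
    \<comment> \<open>excludes \<open>\<nu> = 1/4\<close> (in particular \<open>k = 0\<close>), where the monodromy is unipotent and transforms need not close\<close>
    and not_parabolic: "\<not> \<rho> * M dvd k"
    \<comment> \<open>excludes the constant transforms\<close>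
    and "\<nu> \<noteq> 0"
  shows "isothermic_with D f \<mu> \<and>
    (\<forall>fh. darboux_transform D f \<mu> \<nu> fh \<longrightarrow>
       isothermic D fh \<and>
       (\<forall>m n. (m, n) \<in> D \<longrightarrow> (m + int (\<rho> * M), n) \<in> D \<longrightarrow>
          fh (m + int (\<rho> * M), n) = fh (m, n)))"
proof (intro conjI allI impI)
  define \<phi> \<psi> where "\<phi> = pi / M" and "\<psi> = k * pi / (\<rho> * M)"
  have \<phi>: "0 < \<phi>" "\<phi> < pi / 2"
    using \<open>M > 2\<close> by (simp_all add: \<phi>_def field_simps)
  have s\<phi>: "sin \<phi> \<noteq> 0" and c\<phi>: "cos \<phi> \<noteq> 0"
    using \<phi> sin_gt_zero[of \<phi>] cos_gt_zero[of \<phi>] by simp_all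
  have c\<psi>: "cos \<psi> \<noteq> 0" using tan_defined by (simp add: \<psi>_def)
  \<comment> \<open>A zero would make \<open>\<psi>\<close> an integer multiple of
    \<open>pi\<close>, hence \<open>k\<close> a multiple of \<open>\<rho> * M\<close>.\<close>
  have s\<psi>: "sin \<psi> \<noteq> 0"
  proof
    assume "sin \<psi> = 0"
    then obtain i where "\<psi> = of_int i * pi" by (auto simp: sin_zero_iff_int2)
    then have "real k = of_int i * real (\<rho> * M)"
      using \<open>\<rho> > 0\<close> \<open>M > 2\<close> by (simp add: \<psi>_def field_simps)
    then have "int k = i * int (\<rho> * M)"
      by (metis of_int_eq_iff of_int_mult of_int_of_nat_eq)
    then show False
      using not_parabolic by (metis dvd_triv_right int_dvd_int_iff)
  qed
  have \<theta>: "2 * pi / M = 2 * \<phi>" by (simp add: \<phi>_def)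
  have exp: "exp (2 * of_real pi * \<i> / of_nat M) = cis (2 * pi / M)"
    unfolding cis_conv_exp by (rule arg_cong[where f = exp]) simp
  have W: "(cmod (1 - cis (2 * pi / M)))\<^sup>2 = 4 * (sin \<phi>)\<^sup>2"
    unfolding \<theta> by (rule cmod_one_minus_cis_double)
  have w: "cis (2 * pi / M) \<noteq> 1"
    using W s\<phi> by auto
  show iso: "isothermic_with D f \<mu>"
    unfolding f_def
  proof (rule revolution_surface_isothermic_with[OF w])
    fix m n
    assume D: "(m, n) \<in> D"
    show "p n \<noteq> 0" by (rule p_nonzero[OF D])
    show "1 / \<mu> {(m, n), (m + 1, n)} = (cmod (1 - cis (2 * pi / M)))\<^sup>2"
      if "(m + 1, n) \<in> D"
      using mu_horizontal[OF D that] unfolding exp .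
    assume D': "(m, n + 1) \<in> D"
    show "(p n, q n) \<noteq> (p (n + 1), q (n + 1))" by (rule profile_regular[OF D D'])
    show "1 / \<mu> {(m, n), (m, n + 1)} =
        - (((p n - p (n + 1))\<^sup>2 + (q n - q (n + 1))\<^sup>2) / (p n * p (n + 1)))"
      by (rule mu_vertical[OF D D'])
  qed
  fix fh
  assume fh: "darboux_transform D f \<mu> \<nu> fh"
  show "isothermic D fh"
    using isothermic_darboux_transform[OF iso fh \<open>\<nu> \<noteq> 0\<close>] by (auto simp: isothermic_def)
  fix m n :: int
  assume D: "(m, n) \<in> D" "(m + int (\<rho> * M), n) \<in> D"
  \<comment> \<open>A rectangle containing both ends of the period contains the whole row between
    them.\<close>
  have row: "(m + int t, n) \<in> D" if "t \<le> \<rho> * M" for t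
  proof -
    obtain I J where IJ: "int_interval I" "D = I \<times> J"
      using \<open>rectangular_domain D\<close> by (auto simp: rectangular_domain_def)
    have "m + int t \<in> {m..m + int (\<rho> * M)}"
      using that by (simp only: atLeastAtMost_iff) linarith
    then show ?thesis using D IJ unfolding int_interval_def by blast
  qed
  \<comment> \<open>This is \<open>\<nu> / \<mu>\<close> on horizontal edges, because
    \<open>1 / \<mu>\<close> there equals \<open>4 * (sin \<phi>)\<^sup>2\<close>.\<close>
  define r where "r = \<nu> * (4 * (sin \<phi>)\<^sup>2)"
  have r0: "r \<noteq> 0" using \<open>\<nu> \<noteq> 0\<close> s\<phi> by (simp add: r_def)
  \<comment> \<open>Here the special form of \<open>\<nu>\<close> enters: \<open>1 - r\<close>
    becomes \<open>(cos \<phi>)\<^sup>2 * (1 + (tan \<psi>)\<^sup>2)\<close>.\<close>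
  have r1: "1 - r = (cos \<phi> / cos \<psi>)\<^sup>2"
  proof -
    have \<nu>: "\<nu> = 1 / 4 * (1 - (cos \<phi> / sin \<phi>)\<^sup>2 * (sin \<psi> / cos \<psi>)\<^sup>2)"
      using nu_def by (simp add: \<phi>_def \<psi>_def cot_def tan_def)
    have "1 - r = 1 - (sin \<phi>)\<^sup>2 + (cos \<phi>)\<^sup>2 * (sin \<psi>)\<^sup>2 / (cos \<psi>)\<^sup>2"
      unfolding r_def \<nu> using s\<phi> c\<psi> by (simp add: field_simps)
    also have "\<dots> = (cos \<phi>)\<^sup>2 + (cos \<phi>)\<^sup>2 * (sin \<psi>)\<^sup>2 / (cos \<psi>)\<^sup>2"
      by (simp add: cos_squared_eq[of \<phi>])
    also have "\<dots> = (cos \<phi>)\<^sup>2 * ((cos \<psi>)\<^sup>2 + (sin \<psi>)\<^sup>2) / (cos \<psi>)\<^sup>2"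
      using c\<psi> by (simp add: field_simps del: sin_cos_squared_add sin_cos_squared_add2)
    finally show ?thesis by (simp add: power_divide)
  qed
  let ?f = "\<lambda>t. f (m + int t, n)" and ?fh = "\<lambda>t. fh (m + int t, n)"
  have cr: "has_real_cr (?f t) (?f (t + 1)) (?fh (t + 1)) (?fh t) r" if "t < \<rho> * M" for t
  proof -
    have t: "(m + int t, n) \<in> D" "(m + int t + 1, n) \<in> D"
      using row[of t] row[of "t + 1"] that by (simp_all add: add_ac)
    then have "has_real_cr (?f t) (f (m + int t + 1, n)) (fh (m + int t + 1, n)) (?fh t)
        (\<nu> / \<mu> {(m + int t, n), (m + int t + 1, n)})"
      using fh by (auto simp: darboux_transform_def lattice_edge_def)
    moreover have "\<nu> / \<mu> {(m + int t, n), (m + int t + 1, n)} = r"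
    proof -
      have "1 / \<mu> {(m + int t, n), (m + int t + 1, n)} = 4 * (sin \<phi>)\<^sup>2"
        using mu_horizontal[OF t] unfolding exp W .
      then show ?thesis by (simp add: r_def flip: \<open>1 / _ = _\<close>)
    qed
    ultimately show ?thesis by (simp add: add_ac)
  qed
  note e = revolution_surface_horizontal_edges[where p = p and n = n and q = q, OF p_nonzero[OF D(1)] w,
      folded f_def, unfolded \<theta>]
  have "?fh (\<rho> * M) = ?fh 0"
  proof (rule darboux_row_closed[where f = ?f, OF cr r0 r1 _ _ _ c\<phi> c\<psi> s\<psi>])
    show "?f (t + 1) - ?f t \<noteq> 0" for t
      using e(1)[of "m + int t"] by (simp add: add_ac)
    show "?f (t + 2) - ?f (t + 1) = quat_of_complex (cis (- 2 * \<phi>)) * (?f (t + 1) - ?f t)" for t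
      using e(2)[of "m + int t"] by (simp add: add_ac)
    show "?f (t + 2) - ?f (t + 1) = (?f (t + 1) - ?f t) * quat_of_complex (cis (2 * \<phi>))" for t
      using e(3)[of "m + int t"] by (simp add: add_ac)
    show "real (\<rho> * M) * \<phi> = \<rho> * pi" "real (\<rho> * M) * \<psi> = k * pi"
      using \<open>\<rho> > 0\<close> \<open>M > 2\<close> by (simp_all add: \<phi>_def \<psi>_def)
    \<comment> \<open>Over \<open>\<rho> * M\<close> steps the surface itself makes
      \<open>\<rho>\<close> full turns.\<close>
    have "2 * pi / M * of_int (m + int (\<rho> * M)) = 2 * pi / M * of_int m + 2 * pi * real \<rho>"
      using \<open>M > 2\<close> by (simp add: field_simps)
    then have "cis (2 * pi / M * of_int (m + int (\<rho> * M))) = cis (2 * pi / M * of_int m)"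
      by (simp only: cis_mult[symmetric]) (simp add: cis_multiple_2pi)
    then show "?f (\<rho> * M) = ?f 0"
      unfolding f_def revolution_surface_cis by simp
  qed
  then show "fh (m + int (\<rho> * M), n) = fh (m, n)" by simp
qed

end
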